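(* Let $n$ be a non-negative integer such that the Fermat number $2^{2^n}+1$ is not prime. Let $a$ be a positive integer with $a<2^n$. Then there are exactly $2^t$ positive integers $m$ such that $\varphi(m)=2^{2^n+a}$, where $t$ is the number of prime Fermat numbers that are less than $2^{2^n}+1$.
   Context: $\varphi$ denotes Euler's totient function. A Fermat number is a number of the form $2^{2^j}+1$ with $j$ a non-negative integer; a prime Fermat number is a Fermat number that is prime. *)

theory Defs
  imports "HOL-Number_Theory.Number_Theory"
begin

definition fermat_number :: "nat \<Rightarrow> nat" where
  "fermat_number j = 2 ^ (2 ^ j) + 1"

definition prime_fermat_numbers :: "nat set" where
  "prime_fermat_numbers = {p. prime p \<and> (\<exists>j. p = fermat_number j)}"

end

theory Submission
  imports Defs
begin

text \<open>
  If \<open>totient m\<close> is a power of two, then \<open>m\<close> is a power of two times a product of distinct Fermat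
  primes, say those with indices in \<open>K\<close>. With \<open>m = 2 ^ k * \<dots>\<close> the exponent of \<open>totient m\<close> is
  \<open>(k - 1) + (\<Sum>j\<in>K. 2 ^ j)\<close>, which remains true for \<open>k = 0\<close> by truncated subtraction. If this
  exponent lies strictly between \<open>2 ^ n\<close> and \<open>2 ^ Suc n\<close> and the \<open>n\<close>-th Fermat number is composite,
  then all indices are less than \<open>n\<close>, so that \<open>(\<Sum>j\<in>K. 2 ^ j) < 2 ^ n\<close>. Hence every set of indices
  of Fermat primes below \<open>n\<close> admits exactly one \<open>k\<close>.
\<close>

lemma odd_fermat_number: "odd (fermat_number j)"
  by (simp add: fermat_number_def)

lemma fermat_number_gt_2: "fermat_number j > 2"
proof -
  have "(2::nat) ^ 1 \<le> 2 ^ (2 ^ j)"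
    by (intro power_increasing) auto
  then show ?thesis by (simp add: fermat_number_def)
qed

lemma fermat_number_less_iff: "fermat_number i < fermat_number j \<longleftrightarrow> i < j"
  by (simp add: fermat_number_def)

lemma inj_fermat_number: "inj fermat_number"
  by (auto simp: inj_def fermat_number_def)

text \<open>Modulo \<open>x + 1\<close> the number \<open>x\<close> is -1, and an odd power of -1 is
  -1. The detour through \<open>int\<close> makes -1 available.\<close>

lemma Suc_dvd_power_odd_Suc:
  fixes x q :: nat
  assumes "odd q"
  shows "x + 1 dvd x ^ q + 1"
proof -
  have "[int x = - 1] (mod int x + 1)"
    by (simp add: cong_iff_dvd_diff)
  then have "[int x ^ q = (- 1) ^ q] (mod int x + 1)"
    by (rule cong_pow)
  then have "int x + 1 dvd int x ^ q + 1"
    using assms by (simp add: cong_iff_dvd_diff)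
  then have "int (x + 1) dvd int (x ^ q + 1)"
    by (simp add: add.commute)
  then show ?thesis
    by (simp only: of_nat_dvd_iff)
qed

text \<open>Write \<open>i = 2 ^ j * q\<close> with \<open>q\<close> odd. Then the
  \<open>j\<close>-th Fermat number divides \<open>2 ^ i + 1\<close> and exceeds 1, so primality
  forces equality.\<close>

lemma prime_power_2_plus_1_imp_fermat_number:
  assumes "prime (2 ^ i + 1 :: nat)" and "i > 0"
  shows "\<exists>j. 2 ^ i + 1 = fermat_number j"
proof -
  obtain q where q: "i = 2 ^ multiplicity 2 i * q" "odd q"
    using multiplicity_decompose'[of i 2] assms(2) by auto
  define j where "j = multiplicity 2 i"
  have "fermat_number j dvd (2 ^ (2 ^ j)) ^ q + 1"
    unfolding fermat_number_def by (rule Suc_dvd_power_odd_Suc[OF q(2)])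
  also have "(2 ^ (2 ^ j)) ^ q + 1 = (2 ^ i + 1 :: nat)"
    using q(1) by (simp add: j_def power_mult [symmetric])
  finally show ?thesis
    using assms(1) fermat_number_gt_2[of j] by (intro exI[of _ j]) (auto simp: prime_nat_iff)
qed

text \<open>Since \<open>totient p = p - 1\<close> divides \<open>totient m\<close>, it is a power
  of two. A square factor \<open>p ^ 2\<close> would put \<open>p\<close> itself into
  \<open>totient m\<close>, but no odd prime divides a power of two.\<close>

lemma odd_prime_dvd_totient_power_2:
  fixes m p :: nat
  assumes "totient m = 2 ^ N" and p: "prime p" "p \<noteq> 2" "p dvd m"
  shows "\<exists>j. p = fermat_number j" and "multiplicity p m = 1"
proof -
  have m: "m > 0"
    using assms(1) by (metis totient_gt_0_iff zero_less_numeral zero_less_power)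
  have p2: "p > 2"
    using p prime_ge_2_nat[of p] by simp
  have "p - 1 dvd 2 ^ N"
    using totient_dvd[OF p(3)] assms(1) totient_prime[OF p(1)] by simp
  then obtain i where i: "p - 1 = 2 ^ i"
    using divides_primepow_nat[OF two_is_prime_nat, of "p - 1" N] by auto
  have "i > 0"
    using i p2 by (cases i) auto
  moreover have "p = 2 ^ i + 1"
    using i p2 by simp
  ultimately show "\<exists>j. p = fermat_number j"
    using prime_power_2_plus_1_imp_fermat_number p(1) by metis
  have "\<not> p ^ 2 dvd m"
  proof
    assume "p ^ 2 dvd m"
    then have "totient (p ^ 2) dvd 2 ^ N"
      using totient_dvd assms(1) by metis
    then have "p dvd 2 ^ N"
      using totient_prime_power[OF p(1), of 2] by (auto dest: dvd_mult_left)
    then show False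
      using p(1,2) by (metis prime_dvd_power primes_dvd_imp_eq two_is_prime_nat)
  qed
  then show "multiplicity p m = 1"
    using p m by (intro multiplicity_eqI) (simp_all add: power2_eq_square)
qed

text \<open>Distinct primes are coprime, so \<open>totient\<close> is multiplicative here, and each
  factor contributes \<open>fermat_number j - 1 = 2 ^ (2 ^ j)\<close>.\<close>

lemma totient_prod_fermat_number:
  assumes "\<And>j. j \<in> K \<Longrightarrow> prime (fermat_number j)"
  shows "totient (\<Prod>j\<in>K. fermat_number j) = 2 ^ (\<Sum>j\<in>K. 2 ^ j)"
proof -
  have "pairwise coprime (fermat_number ` K)"
    using assms by (auto simp: pairwise_def intro!: primes_coprime)
  then have "totient (\<Prod>j\<in>K. fermat_number j) = (\<Prod>j\<in>K. totient (fermat_number j))"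
    using inj_fermat_number by (intro totient_prod_coprime) (auto intro: inj_on_subset)
  also have "\<dots> = (\<Prod>j\<in>K. 2 ^ (2 ^ j))"
    using assms by (intro prod.cong) (simp_all add: totient_prime, simp add: fermat_number_def)
  finally show ?thesis
    by (simp add: power_sum)
qed

lemma totient_power_2_times_prod_fermat_number:
  assumes "\<And>j. j \<in> K \<Longrightarrow> prime (fermat_number j)"
  shows "totient (2 ^ k * (\<Prod>j\<in>K. fermat_number j)) = 2 ^ (k - 1 + (\<Sum>j\<in>K. 2 ^ j))"
proof -
  have "coprime (2 ^ k) (\<Prod>j\<in>K. fermat_number j)"
    by (intro prod_coprime_right) (simp add: odd_fermat_number)
  moreover have "totient (2 ^ k) = 2 ^ (k - 1)"
    by (cases "k = 0") (simp_all add: totient_prime_power)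
  ultimately show ?thesis
    using totient_prod_fermat_number[OF assms] by (simp add: totient_mult_coprime power_add)
qed

lemma totient_eq_power_2_decompose:
  fixes m :: nat
  assumes "totient m = 2 ^ N"
  obtains K k where "finite K" "\<forall>j\<in>K. prime (fermat_number j)"
    "m = 2 ^ k * (\<Prod>j\<in>K. fermat_number j)"
proof -
  have m: "m \<noteq> 0"
    using assms by (metis totient_0 power_not_zero zero_neq_numeral)
  define K where "K = {j. prime (fermat_number j) \<and> fermat_number j dvd m}"
  have img: "fermat_number ` K = prime_factors m - {2}"
  proof (intro equalityI subsetI)
    fix p assume "p \<in> fermat_number ` K"
    then obtain j where "p = fermat_number j" "j \<in> K"
      by auto
    then show "p \<in> prime_factors m - {2}"
      using m fermat_number_gt_2[of j] by (simp add: K_def in_prime_factors_iff)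
  next
    fix p assume "p \<in> prime_factors m - {2}"
    then show "p \<in> fermat_number ` K"
      using odd_prime_dvd_totient_power_2(1)[OF assms, of p] by (auto simp: K_def)
  qed
  have "finite (fermat_number ` K)"
    unfolding img by simp
  then have fin: "finite K"
    using inj_fermat_number by (auto dest!: finite_imageD intro: inj_on_subset)
  have "m = (\<Prod>p\<in>prime_factors m. p ^ multiplicity p m)"
    using m prime_factorization_nat by blast
  \<comment> \<open>Inserting 2 treats odd and even \<open>m\<close> alike: if \<open>m\<close> is
    odd, the new factor is \<open>2 ^ 0 = 1\<close>.\<close>
  also have "\<dots> = (\<Prod>p\<in>insert 2 (prime_factors m). p ^ multiplicity p m)"
    by (rule prod.mono_neutral_left)
      (auto simp: in_prime_factors_iff m not_dvd_imp_multiplicity_0)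
  also have "\<dots> = 2 ^ multiplicity 2 m * (\<Prod>p\<in>prime_factors m - {2}. p ^ multiplicity p m)"
    by (simp add: prod.insert_remove)
  also have "(\<Prod>p\<in>prime_factors m - {2}. p ^ multiplicity p m) = \<Prod>(prime_factors m - {2})"
    using odd_prime_dvd_totient_power_2(2)[OF assms]
    by (intro prod.cong) (simp_all add: in_prime_factors_iff)
  also have "\<dots> = (\<Prod>j\<in>K. fermat_number j)"
    unfolding img [symmetric] using inj_fermat_number
    by (subst prod.reindex) (auto intro: inj_on_subset)
  finally show ?thesis
    using that fin by (auto simp: K_def)
qed

lemma sum_power_2_less:
  assumes "K \<subseteq> {..<n}"
  shows "(\<Sum>j\<in>K. 2 ^ j) < (2 ^ n :: nat)"
proof -
  have "(\<Sum>j\<in>K. 2 ^ j) \<le> (\<Sum>j<n. 2 ^ j :: nat)"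
    using assms by (intro sum_mono2) auto
  also have "\<dots> < 2 ^ n"
    by (induction n) auto
  finally show ?thesis .
qed

theorem theorem2:
  fixes n a t :: nat
  assumes "\<not> prime (fermat_number n)"
    and "0 < a" and "a < 2 ^ n"
    and "t = card {p \<in> prime_fermat_numbers. p < fermat_number n}"
  shows "finite {m :: nat. 0 < m \<and> totient m = 2 ^ (2 ^ n + a)}
    \<and> card {m :: nat. 0 < m \<and> totient m = 2 ^ (2 ^ n + a)} = 2 ^ t"
proof -
  define J where "J = {j. j < n \<and> prime (fermat_number j)}"
  define N where "N = 2 ^ n + a"
  \<comment> \<open>The exponent of 2 solves \<open>k - 1 + (\<Sum>j\<in>K. 2 ^ j) = N\<close> for
    \<open>k\<close>, so \<open>g K\<close> is the candidate solution with index set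
    \<open>K\<close>.\<close>
  define g where "g = (\<lambda>K. 2 ^ (N + 1 - (\<Sum>j\<in>K. 2 ^ j)) * (\<Prod>j\<in>K. fermat_number j))"
  let ?M = "{m :: nat. 0 < m \<and> totient m = 2 ^ N}"
  have finJ: "finite J"
    by (simp add: J_def)
  have "{p \<in> prime_fermat_numbers. p < fermat_number n} = fermat_number ` J"
    by (auto simp: prime_fermat_numbers_def J_def fermat_number_less_iff)
  then have t: "t = card J"
    using assms(4) inj_fermat_number by (simp add: card_image inj_on_subset)
  \<comment> \<open>Strictness matters twice: the subtraction in \<open>g\<close> is then not
    truncated, and \<open>k = 0\<close> cannot occur for a solution.\<close>
  have sum_less: "(\<Sum>j\<in>K. 2 ^ j) < N" if "K \<subseteq> J" for K
  proof -
    have "(\<Sum>j\<in>K. 2 ^ j) < (2 ^ n :: nat)"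
      using that by (intro sum_power_2_less) (auto simp: J_def)
    then show ?thesis by (simp add: N_def)
  qed
  \<comment> \<open>The index set can be read off from the Fermat primes dividing
    \<open>g K\<close>, which makes \<open>g\<close> injective on \<open>Pow J\<close>.\<close>
  have dvd_g: "fermat_number j dvd g K \<longleftrightarrow> j \<in> K" if j: "j \<in> J" and K: "K \<subseteq> J" for j K
  proof
    assume "fermat_number j dvd g K"
    moreover have pr: "prime (fermat_number j)"
      using j by (simp add: J_def)
    moreover have "\<not> fermat_number j dvd 2 ^ e" for e
      using pr fermat_number_gt_2[of j]
      by (metis less_irrefl prime_dvd_power primes_dvd_imp_eq two_is_prime_nat)
    ultimately have "fermat_number j dvd (\<Prod>i\<in>K. fermat_number i)"
      by (auto simp: g_def prime_dvd_mult_iff)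
    then obtain i where "i \<in> K" "fermat_number j dvd fermat_number i"
      using pr finite_subset[OF K finJ] by (auto simp: prime_dvd_prod_iff)
    moreover from this have "fermat_number j = fermat_number i"
      using pr K by (intro primes_dvd_imp_eq) (auto simp: J_def)
    ultimately show "j \<in> K"
      using inj_fermat_number by (auto simp: inj_def)
  next
    assume "j \<in> K"
    then show "fermat_number j dvd g K"
      using finite_subset[OF K finJ] by (auto simp: g_def intro: dvd_mult)
  qed
  have "inj_on g (Pow J)"
  proof (rule inj_onI)
    fix K L assume "K \<in> Pow J" "L \<in> Pow J" "g K = g L"
    then show "K = L"
      using dvd_g[of _ K] dvd_g[of _ L] by auto
  qed
  moreover have "g ` Pow J = ?M"
  proof (intro equalityI subsetI)
    fix m assume "m \<in> g ` Pow J"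
    then obtain K where K: "K \<subseteq> J" "m = g K"
      by auto
    have "totient m = 2 ^ (N + 1 - (\<Sum>j\<in>K. 2 ^ j) - 1 + (\<Sum>j\<in>K. 2 ^ j))"
      unfolding K(2) g_def using K(1)
      by (intro totient_power_2_times_prod_fermat_number) (auto simp: J_def)
    also have "N + 1 - (\<Sum>j\<in>K. 2 ^ j) - 1 + (\<Sum>j\<in>K. 2 ^ j) = N"
      using sum_less[OF K(1)] by simp
    finally have "totient m = 2 ^ N" .
    moreover from this have "m > 0"
      by (metis totient_gt_0_iff zero_less_numeral zero_less_power)
    ultimately show "m \<in> ?M"
      by simp
  next
    fix m assume "m \<in> ?M"
    then have tot: "totient m = 2 ^ N"
      by simp
    obtain K k where K: "finite K" "\<forall>j\<in>K. prime (fermat_number j)"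
      and m: "m = 2 ^ k * (\<Prod>j\<in>K. fermat_number j)"
      by (rule totient_eq_power_2_decompose[OF tot])
    have N: "N = k - 1 + (\<Sum>j\<in>K. 2 ^ j)"
      using tot totient_power_2_times_prod_fermat_number[of K k] K(2) by (simp add: m)
    have KJ: "K \<subseteq> J"
    proof
      fix j assume j: "j \<in> K"
      \<comment> \<open>One summand is at most the whole sum, hence at most \<open>N\<close>, and
        \<open>a < 2 ^ n\<close> gives \<open>N < 2 ^ Suc n\<close>. This leaves only
        \<open>j = n\<close> to exclude, which the compositeness assumption does.\<close>
      have "2 ^ j \<le> (\<Sum>j\<in>K. 2 ^ j :: nat)"
        using j K(1) by (intro member_le_sum) auto
      also have "\<dots> < 2 ^ Suc n"
        using N assms(3) by (simp add: N_def)
      finally have "j < Suc n"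
        by (simp only: power_strict_increasing_iff[of "2::nat"] one_less_numeral_iff semiring_norm)
      moreover have "j \<noteq> n"
        using K(2) j assms(1) by auto
      ultimately show "j \<in> J"
        using K(2) j by (simp add: J_def)
    qed
    \<comment> \<open>For \<open>k = 0\<close> the equation for \<open>N\<close> would make the sum
      equal to \<open>N\<close>, against \<open>sum_less\<close>. So \<open>k\<close> is positive
      and \<open>k - 1\<close> can be inverted.\<close>
    have "k = N + 1 - (\<Sum>j\<in>K. 2 ^ j)"
      using N sum_less[OF KJ] by simp
    then have "m = g K"
      by (simp add: m g_def)
    then show "m \<in> g ` Pow J"
      using KJ by auto
  qed
  ultimately have "bij_betw g (Pow J) ?M"
    by (simp add: bij_betw_def)
  then have "finite ?M \<and> card ?M = card (Pow J)"
    using finJ bij_betw_finite[of g "Pow J" ?M] bij_betw_same_card[of g "Pow J" ?M] by simp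
  then show ?thesis
    using finJ by (simp add: t N_def card_Pow)
qed

end
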